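(* Consider the Two-Stage Robust Matching Bottleneck problem (TSRMB) with an explicit list of $p$ scenarios $\mathcal{S}=\{S_1,\dots,S_p\}$. The $p$-scenario algorithm (run with the value $OPT_2$ of an optimal solution) yields a solution with total cost $O(p^{1.59})\cdot OPT$.
   Context: TSRMB: an instance consists of a set $D$ of drivers, a set $R_1$ of first-stage riders ($m=|R_1|$), a set $R_2$ of potential second-stage riders, a family $\mathcal{S}$ of subsets of $R_2$ (scenarios), and a metric distance $d$ on $V=R_1\cup R_2\cup D$. It is assumed that there are sufficiently many drivers to satisfy both first-stage and second-stage demand. A feasible solution is a set $D_1\subseteq D$ with $|D_1|=|R_1|$. Define $cost_1(D_1,R_1)=\frac1m\sum_{(i,j)\in M_1}d(i,j)$, where $M_1$ is a minimum-weight perfect matching between $R_1$ and $D_1$. For a set of drivers $A$ and a set of riders $S$, $cost_2(A,S)$ is the bottleneck matching cost: the minimum, over all matchings between $A$ and $S$ covering every element of $S$, of the largest distance $d(i,j)$ of a matched pair. The objective (total cost of a solution $D_1$), to be minimized, is $f(D_1)=cost_1(D_1,R_1)+\max_{S\in\mathcal{S}}cost_2(D\setminus D_1,S)$. For an optimal solution $D_1^*$, $OPT_1=cost_1(D_1^*,R_1)$, $OPT_2=\max_{S\in\mathcal{S}}cost_2(D\setminus D_1^*,S)$, $OPT=OPT_1+OPT_2$. TSRMB-1-Scenario$(R_1,S,D)$ denotes an optimal solution of the single-scenario problem $\min_{D_1\subseteq D,\,|D_1|=|R_1|}\{cost_1(D_1,R_1)+cost_2(D\setminus D_1,S)\}$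 (computable exactly in polynomial time). $p$-scenario algorithm (input $R_1$, $S_1,\dots,S_p$, $D$ and the value $OPT_2$): Initialize $\hat S_j:=S_j$ for $j=1,\dots,p$. For $i=1,\dots,\log_2 p$ and, for each such $i$, for $j=1,2,\dots,p/2^i$: let $\sigma(j)=j+p/2^i$; let $M_j$ be a maximum cardinality matching between $\hat S_j$ and $\hat S_{\sigma(j)}$ with edges of weight (distance) at most $2\cdot3^{i-1}\cdot OPT_2$; let $\hat S_{\sigma(j)}^{Match}=\{r\in\hat S_{\sigma(j)} : \exists\, s\in\hat S_j \text{ with } (s,r)\in M_j\}$ and $\hat S_{\sigma(j)}^{Unmatch}=\hat S_{\sigma(j)}\setminus\hat S_{\sigma(j)}^{Match}$; replace $\hat S_j$ by $\hat S_j\cup\hat S_{\sigma(j)}^{Unmatch}$. Finally return $D_1=$ TSRMB-1-Scenario$(R_1,\hat S_1,D)$.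
   Formalization: If scenarios overlap, the maximum matching M_j must match on the σ(j) side every rider common to both sets; for arbitrary maximum matchings the bound fails. Disjoint scenarios are unrestricted. If p is not a power of two, the list is padded with empty scenarios. *)

theory Defs
  imports "HOL-Analysis.Analysis"
begin

section \<open>Matchings\<close>

text \<open>
  A matching between \<open>A\<close> and \<open>B\<close> is a set of pairs. The two sides are treated as the two
  sides of a bipartite graph even if \<open>A\<close> and \<open>B\<close> share elements; in particular a pair
  \<open>(r, r)\<close> (of length 0) is allowed when \<open>r \<in> A \<inter> B\<close>.
\<close>

definition matching_between :: "'v set \<Rightarrow> 'v set \<Rightarrow> ('v \<times> 'v) set \<Rightarrow> bool" where
  "matching_between A B M \<longleftrightarrow> M \<subseteq> A \<times> B \<and> inj_on fst M \<and> inj_on snd M"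

definition perfect_matching_between :: "'v set \<Rightarrow> 'v set \<Rightarrow> ('v \<times> 'v) set \<Rightarrow> bool" where
  "perfect_matching_between A B M \<longleftrightarrow> matching_between A B M \<and> fst ` M = A \<and> snd ` M = B"

definition threshold_matching ::
  "('v \<Rightarrow> 'v \<Rightarrow> real) \<Rightarrow> real \<Rightarrow> 'v set \<Rightarrow> 'v set \<Rightarrow> ('v \<times> 'v) set \<Rightarrow> bool" where
  "threshold_matching d t A B M \<longleftrightarrow> matching_between A B M \<and> (\<forall>(a, b) \<in> M. d a b \<le> t)"

definition max_threshold_matching ::
  "('v \<Rightarrow> 'v \<Rightarrow> real) \<Rightarrow> real \<Rightarrow> 'v set \<Rightarrow> 'v set \<Rightarrow> ('v \<times> 'v) set \<Rightarrow> bool" where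
  "max_threshold_matching d t A B M \<longleftrightarrow>
     threshold_matching d t A B M \<and> (\<forall>N. threshold_matching d t A B N \<longrightarrow> card N \<le> card M)"


section \<open>Instances and costs\<close>

text \<open>
  The scenarios are \<open>S 1, \<dots>, S p\<close>; overlaps and repetitions are allowed. The last conjunct says
  that there are enough drivers for both stages. It guarantees that the minima in the cost functions
  below range over nonempty sets for every feasible first-stage decision.
\<close>

definition tsrmb_instance ::
  "'v set \<Rightarrow> 'v set \<Rightarrow> 'v set \<Rightarrow> ('v \<Rightarrow> 'v \<Rightarrow> real) \<Rightarrow> nat \<Rightarrow> (nat \<Rightarrow> 'v set) \<Rightarrow> bool" where
  "tsrmb_instance R1 R2 D d p S \<longleftrightarrow>
     finite R1 \<and> R1 \<noteq> {} \<and> finite R2 \<and> finite D \<and>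
     Metric_space (R1 \<union> R2 \<union> D) d \<and>
     1 \<le> p \<and> (\<forall>j \<in> {1..p}. S j \<subseteq> R2) \<and>
     (\<forall>j \<in> {1..p}. card R1 + card (S j) \<le> card D)"

definition feasible :: "'v set \<Rightarrow> 'v set \<Rightarrow> 'v set \<Rightarrow> bool" where
  "feasible R1 D D1 \<longleftrightarrow> D1 \<subseteq> D \<and> card D1 = card R1"

definition cost1 :: "('v \<Rightarrow> 'v \<Rightarrow> real) \<Rightarrow> 'v set \<Rightarrow> 'v set \<Rightarrow> real" where
  "cost1 d D1 R1 =
     Min {\<Sum>(i, j) \<in> M. d i j | M. perfect_matching_between R1 D1 M} / real (card R1)"

text \<open>
  Inserting 0 only matters for the empty matching, whose bottleneck is thereby 0.
\<close>

definition bottleneck :: "('v \<Rightarrow> 'v \<Rightarrow> real) \<Rightarrow> ('v \<times> 'v) set \<Rightarrow> real" where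
  "bottleneck d M = Max (insert 0 ((\<lambda>(i, j). d i j) ` M))"

definition cost2 :: "('v \<Rightarrow> 'v \<Rightarrow> real) \<Rightarrow> 'v set \<Rightarrow> 'v set \<Rightarrow> real" where
  "cost2 d A S = Min {bottleneck d M | M. matching_between A S M \<and> snd ` M = S}"

definition worst_cost2 :: "('v \<Rightarrow> 'v \<Rightarrow> real) \<Rightarrow> 'v set \<Rightarrow> 'v set set \<Rightarrow> real" where
  "worst_cost2 d A \<S> = Max (cost2 d A ` \<S>)"

definition total_cost ::
  "'v set \<Rightarrow> 'v set \<Rightarrow> ('v \<Rightarrow> 'v \<Rightarrow> real) \<Rightarrow> 'v set set \<Rightarrow> 'v set \<Rightarrow> real" where
  "total_cost R1 D d \<S> D1 = cost1 d D1 R1 + worst_cost2 d (D - D1) \<S>"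

definition optimal_solution ::
  "'v set \<Rightarrow> 'v set \<Rightarrow> ('v \<Rightarrow> 'v \<Rightarrow> real) \<Rightarrow> 'v set set \<Rightarrow> 'v set \<Rightarrow> bool" where
  "optimal_solution R1 D d \<S> D1 \<longleftrightarrow>
     feasible R1 D D1 \<and>
     (\<forall>D1'. feasible R1 D D1' \<longrightarrow> total_cost R1 D d \<S> D1 \<le> total_cost R1 D d \<S> D1')"

definition tsrmb_1_scenario ::
  "'v set \<Rightarrow> 'v set \<Rightarrow> 'v set \<Rightarrow> ('v \<Rightarrow> 'v \<Rightarrow> real) \<Rightarrow> 'v set \<Rightarrow> bool" where
  "tsrmb_1_scenario R1 S D d D1 \<longleftrightarrow>
     feasible R1 D D1 \<and>
     (\<forall>D1'. feasible R1 D D1' \<longrightarrow>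
        cost1 d D1 R1 + cost2 d (D - D1) S \<le> cost1 d D1' R1 + cost2 d (D - D1') S)"


section \<open>The p-scenario algorithm\<close>

text \<open>
  The algorithm halves the number of active scenarios in every round, which presupposes that \<open>p\<close> is
  a power of two. For other \<open>p\<close> the list is padded with empty scenarios up to length
  \<open>2 ^ rounds p\<close>; if \<open>p\<close> is a power of two, then \<open>2 ^ rounds p = p\<close> and nothing is padded.
\<close>

definition rounds :: "nat \<Rightarrow> nat" where
  "rounds p = nat \<lceil>log 2 (real p)\<rceil>"

definition pad :: "nat \<Rightarrow> (nat \<Rightarrow> 'v set) \<Rightarrow> nat \<Rightarrow> 'v set" where
  "pad p S j = (if j \<in> {1..p} then S j else {})"

text \<open>\<open>partner k i j\<close> is \<open>j + p/2\<^sup>i\<close> for \<open>p = 2\<^sup>k\<close>.\<close>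

definition partner :: "nat \<Rightarrow> nat \<Rightarrow> nat \<Rightarrow> nat" where
  "partner k i j = j + 2 ^ (k - i)"

definition unmatched :: "'v set \<Rightarrow> 'v set \<Rightarrow> ('v \<times> 'v) set \<Rightarrow> 'v set" where
  "unmatched A B M = B - {r \<in> B. \<exists>s \<in> A. (s, r) \<in> M}"

text \<open>
  \<open>hat k M S i j\<close> is the \<open>j\<close>-th set after round \<open>i\<close>, when \<open>2 ^ k\<close> sets \<open>S 1, S 2, \<dots>\<close> are
  processed using the matchings \<open>M i j\<close>. In round \<open>i\<close> only the sets with index at most
  \<open>2 ^ (k - i)\<close> are modified and their partners have larger indices, so processing the indices
  \<open>j\<close> one after the other is the same as processing them simultaneously.
\<close>

fun hat :: "nat \<Rightarrow> (nat \<Rightarrow> nat \<Rightarrow> ('v \<times> 'v) set) \<Rightarrow> (nat \<Rightarrow> 'v set) \<Rightarrow> nat \<Rightarrow> nat \<Rightarrow> 'v set" where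
  "hat k M S 0 j = S j"
| "hat k M S (Suc i) j =
     (if j \<in> {1..2 ^ (k - Suc i)}
      then hat k M S i j \<union>
           unmatched (hat k M S i j) (hat k M S i (partner k (Suc i) j)) (M (Suc i) j)
      else hat k M S i j)"

text \<open>
  The matchings that the algorithm may choose, where \<open>t\<close> is the given value of \<open>OPT\<^sub>2\<close>.
  The last conjunct is a tie-breaking rule among maximum cardinality matchings: riders common to
  both sets are matched on the partner side. It is void when the scenarios are pairwise disjoint.
  For overlapping scenarios it ensures that a rider which is already in the \<open>j\<close>-th set is never
  added to it again as an unmatched rider; without it the union would lose track of a rider (take
  \<open>{r}\<close>, \<open>{r, r'}\<close> and the maximum matching \<open>{(r, r')}\<close>) and the approximation guarantee fails.
  A maximum matching can always be brought into this form by replacing pairs \<open>(r, r')\<close> by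
  \<open>(r, r)\<close>.
\<close>

definition valid_matchings ::
  "('v \<Rightarrow> 'v \<Rightarrow> real) \<Rightarrow> nat \<Rightarrow> (nat \<Rightarrow> 'v set) \<Rightarrow> real \<Rightarrow> (nat \<Rightarrow> nat \<Rightarrow> ('v \<times> 'v) set) \<Rightarrow> bool" where
  "valid_matchings d k S t M \<longleftrightarrow>
     (\<forall>i \<in> {1..k}. \<forall>j \<in> {1..2 ^ (k - i)}.
        let A = hat k M S (i - 1) j; B = hat k M S (i - 1) (partner k i j)
        in max_threshold_matching d (2 * 3 ^ (i - 1) * t) A B (M i j) \<and>
           A \<inter> B \<subseteq> snd ` M i j)"

definition p_scenario_output ::
  "'v set \<Rightarrow> 'v set \<Rightarrow> ('v \<Rightarrow> 'v \<Rightarrow> real) \<Rightarrow> nat \<Rightarrow> (nat \<Rightarrow> 'v set) \<Rightarrow> real \<Rightarrow> 'v set \<Rightarrow> bool" where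
  "p_scenario_output R1 D d p S t D1 \<longleftrightarrow>
     (\<exists>M. valid_matchings d (rounds p) (pad p S) t M \<and>
          tsrmb_1_scenario R1 (hat (rounds p) M (pad p S) (rounds p) 1) D d D1)"

end

theory Submission
  imports Defs
begin

text \<open>
  Call \<open>B\<close> embeddable into \<open>A\<close> within \<open>t\<close> if some injection \<open>B \<rightarrow> A\<close> moves every point by at most
  \<open>t\<close>; thus \<open>cost\<^sub>2(A, S) \<le> t\<close> iff \<open>S\<close> embeds into \<open>A\<close> within \<open>t\<close>. Suppose \<open>A\<close> and \<open>B\<close> embed into
  the set of drivers \<open>D - D\<^sub>1\<^sup>*\<close> within \<open>t\<close> and let \<open>N\<close> be a maximum matching of \<open>A\<close> and \<open>B\<close> for the
  threshold \<open>2t\<close>. Let every unmatched rider of \<open>B\<close> keep its driver. A rider of \<open>A\<close> that thereby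
  loses its driver takes the driver of its \<open>N\<close>-partner, at distance at most \<open>2t + t\<close>, and so on. A
  displaced rider without partner would give an augmenting path, contradicting maximality. Hence
  \<open>A\<close> with the unmatched riders of \<open>B\<close> embeds within \<open>3t\<close>, and the final set embeds within
  \<open>3\<^sup>k OPT\<^sub>2\<close>. Conversely, going to partners embeds every scenario into the final set within
  \<open>\<Sum>\<^sub>i 2 \<cdot> 3\<^sup>i OPT\<^sub>2 = (3\<^sup>k - 1) OPT\<^sub>2\<close>. Since \<open>k < log\<^sub>2 p + 1\<close> and \<open>log\<^sub>2 3 < 1.59\<close>, the total cost is
  \<open>O(3\<^sup>k) OPT = O(p\<^sup>1\<^sup>.\<^sup>5\<^sup>9) OPT\<close>.
\<close>

section \<open>Embeddings with bounded displacement\<close>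

definition embeds :: "('v \<Rightarrow> 'v \<Rightarrow> real) \<Rightarrow> real \<Rightarrow> 'v set \<Rightarrow> 'v set \<Rightarrow> bool" where
  "embeds d t B A \<longleftrightarrow> (\<exists>f. inj_on f B \<and> f ` B \<subseteq> A \<and> (\<forall>x \<in> B. d x (f x) \<le> t))"

lemma embeds_empty: "embeds d t {} A"
  by (simp add: embeds_def)

text \<open>Supplies the cardinality condition of \<open>cost2_attained\<close> for the merged set,
  whose size the instance assumptions do not bound directly.\<close>

lemma embeds_card_le: "embeds d t B A \<Longrightarrow> finite A \<Longrightarrow> card B \<le> card A"
  unfolding embeds_def using card_inj_on_le by blast

lemma embeds_mono: "embeds d s B A \<Longrightarrow> s \<le> t \<Longrightarrow> A \<subseteq> A' \<Longrightarrow> embeds d t B A'"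
  unfolding embeds_def by (meson order_trans)

lemma embeds_subset:
  assumes "Metric_space V d" "B \<subseteq> A" "B \<subseteq> V" "0 \<le> t"
  shows "embeds d t B A"
  unfolding embeds_def
  using assms Metric_space.mdist_zero[OF assms(1)] by (intro exI[of _ id]) auto

lemma embeds_trans:
  assumes "Metric_space V d" "A \<subseteq> V" "B \<subseteq> V" "C \<subseteq> V"
    and "embeds d s A B" "embeds d t B C"
  shows "embeds d (s + t) A C"
proof -
  obtain f where f: "inj_on f A" "f ` A \<subseteq> B" "\<forall>x \<in> A. d x (f x) \<le> s"
    using assms(5) unfolding embeds_def by blast
  obtain g where g: "inj_on g B" "g ` B \<subseteq> C" "\<forall>x \<in> B. d x (g x) \<le> t"
    using assms(6) unfolding embeds_def by blast
  have "d x (g (f x)) \<le> s + t" if "x \<in> A" for x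
  proof -
    have "d x (g (f x)) \<le> d x (f x) + d (f x) (g (f x))"
      using that f(2) g(2) assms(2-4) by (intro Metric_space.triangle[OF assms(1)]) (auto simp: subset_iff)
    also have "\<dots> \<le> s + t"
      using that f g by (intro add_mono) auto
    finally show ?thesis .
  qed
  moreover have "inj_on (g \<circ> f) A"
    using f g by (meson comp_inj_on inj_on_subset)
  ultimately show ?thesis
    unfolding embeds_def using f(2) g(2) by (intro exI[of _ "g \<circ> f"]) auto
qed


section \<open>Costs\<close>

lemma finite_matchings:
  assumes "finite A" "finite B"
  shows "finite {M. matching_between A B M}"
  by (rule finite_subset[of _ "Pow (A \<times> B)"]) (use assms in \<open>auto simp: matching_between_def\<close>)

lemma finite_matching: "matching_between A B M \<Longrightarrow> finite A \<Longrightarrow> finite B \<Longrightarrow> finite M"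
  unfolding matching_between_def by (meson finite_SigmaI finite_subset)

lemma some_fst_in: "b \<in> snd ` N \<Longrightarrow> (SOME a. (a, b) \<in> N, b) \<in> N"
  by (rule someI_ex) auto

lemma some_snd_in: "a \<in> fst ` N \<Longrightarrow> (a, SOME b. (a, b) \<in> N) \<in> N"
  by (rule someI_ex) auto

lemma inj_on_fst_unique: "inj_on fst N \<Longrightarrow> (a, b) \<in> N \<Longrightarrow> (a, b') \<in> N \<Longrightarrow> b = b'"
  using inj_onD[of fst N "(a, b)" "(a, b')"] by simp

lemma inj_on_snd_unique: "inj_on snd N \<Longrightarrow> (a, b) \<in> N \<Longrightarrow> (a', b) \<in> N \<Longrightarrow> a = a'"
  using inj_onD[of snd N "(a, b)" "(a', b)"] by simp

text \<open>The graph of the embedding, with its pairs turned around, is one of the matchings in the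
  minimum. The hypothesis \<open>0 \<le> t\<close> accounts for the 0 inserted in
  \<open>bottleneck\<close>.\<close>

lemma cost2_le:
  assumes "Metric_space V d" "A \<subseteq> V" "S \<subseteq> V" "finite A" "finite S" "0 \<le> t" "embeds d t S A"
  shows "cost2 d A S \<le> t"
proof -
  obtain f where f: "inj_on f S" "f ` S \<subseteq> A" "\<forall>x \<in> S. d x (f x) \<le> t"
    using assms(7) unfolding embeds_def by blast
  define M where "M = (\<lambda>x. (f x, x)) ` S"
  have M: "matching_between A S M" "snd ` M = S"
    using f(1,2) by (force simp: M_def matching_between_def inj_on_def)+
  have "finite {bottleneck d M | M. matching_between A S M \<and> snd ` M = S}"
    by (rule finite_subset[of _ "bottleneck d ` {M. matching_between A S M}"])
       (use finite_matchings[OF assms(4,5)] in auto)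
  then have "cost2 d A S \<le> bottleneck d M"
    unfolding cost2_def using M by (intro Min_le) auto
  also have "bottleneck d M \<le> t"
    unfolding bottleneck_def
    using assms f Metric_space.commute[OF assms(1)] by (subst Max_le_iff) (auto simp: M_def)
  finally show ?thesis .
qed

text \<open>By the cardinality hypothesis some injection exists, so \<open>Min\<close> ranges over a
  nonempty finite set and is attained. Inverting an optimal matching gives the embedding.\<close>

lemma cost2_attained:
  assumes "Metric_space V d" "finite A" "finite S" "card S \<le> card A"
  shows "0 \<le> cost2 d A S" and "embeds d (cost2 d A S) S A"
proof -
  let ?B = "{bottleneck d M | M. matching_between A S M \<and> snd ` M = S}"
  obtain f where f: "inj_on f S" "f ` S \<subseteq> A"
    using card_le_inj[OF assms(3,2,4)] by blast
  have "matching_between A S ((\<lambda>x. (f x, x)) ` S)" "snd ` (\<lambda>x. (f x, x)) ` S = S"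
    using f by (force simp: matching_between_def inj_on_def)+
  then have "?B \<noteq> {}"
    by blast
  moreover have "finite ?B"
    by (rule finite_subset[of _ "bottleneck d ` {M. matching_between A S M}"])
       (use finite_matchings[OF assms(2,3)] in auto)
  ultimately have "cost2 d A S \<in> ?B"
    unfolding cost2_def by (rule Min_in[rotated])
  then obtain M where M: "matching_between A S M" "snd ` M = S" "cost2 d A S = bottleneck d M"
    by blast
  have "finite M"
    using M(1) assms(2,3) by (rule finite_matching)
  then show "0 \<le> cost2 d A S"
    by (simp add: M(3) bottleneck_def)
  have le: "d a x \<le> cost2 d A S" if "(a, x) \<in> M" for a x
    unfolding M(3) bottleneck_def using \<open>finite M\<close> that by (intro Max_ge) force+
  define g where "g x = (SOME a. (a, x) \<in> M)" for x
  have g: "(g x, x) \<in> M" if "x \<in> S" for x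
    unfolding g_def using that M(2) some_fst_in by metis
  have "inj_on g S"
    using g M(1) inj_on_fst_unique unfolding matching_between_def by (metis inj_onI)
  moreover have "g ` S \<subseteq> A"
    using g M(1) by (auto simp: matching_between_def)
  ultimately show "embeds d (cost2 d A S) S A"
    unfolding embeds_def using le g Metric_space.commute[OF assms(1)] by metis
qed

lemma cost1_nonneg:
  assumes "Metric_space V d" "finite R" "finite D1" "card D1 = card R"
  shows "0 \<le> cost1 d D1 R"
proof -
  let ?c = "\<lambda>M. \<Sum>(i, j) \<in> M. d i j"
  let ?B = "{?c M | M. perfect_matching_between R D1 M}"
  obtain f where f: "bij_betw f R D1"
    using assms finite_same_card_bij by metis
  have "perfect_matching_between R D1 ((\<lambda>x. (x, f x)) ` R)"
    using f by (force simp: perfect_matching_between_def matching_between_def bij_betw_def inj_on_def)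
  then have "?B \<noteq> {}"
    by blast
  moreover have "finite ?B"
    by (rule finite_subset[of _ "?c ` {M. matching_between R D1 M}"])
       (use finite_matchings[OF assms(2,3)] in \<open>auto simp: perfect_matching_between_def\<close>)
  ultimately have "Min ?B \<in> ?B"
    by (rule Min_in[rotated])
  moreover have "0 \<le> ?c M" for M
    using Metric_space.nonneg[OF assms(1)] by (intro sum_nonneg) auto
  ultimately show ?thesis
    unfolding cost1_def by (auto intro!: divide_nonneg_nonneg)
qed


section \<open>Merging two scenarios\<close>

text \<open>
  With \<open>f\<close> and \<open>g\<close> assigning drivers to the riders in \<open>A\<close> and \<open>B\<close>, these are the riders of \<open>A\<close>
  that lose their driver when the riders in \<open>U\<close> keep theirs and displaced riders take over the
  driver of their \<open>N\<close>-partner.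
\<close>

inductive_set displaced ::
  "('v \<Rightarrow> 'w) \<Rightarrow> ('v \<Rightarrow> 'w) \<Rightarrow> 'v set \<Rightarrow> 'v set \<Rightarrow> ('v \<times> 'v) set \<Rightarrow> 'v set"
  for f g A U N where
  start: "a \<in> A \<Longrightarrow> u \<in> U \<Longrightarrow> f a = g u \<Longrightarrow> a \<in> displaced f g A U N"
| step: "a' \<in> displaced f g A U N \<Longrightarrow> (a', b) \<in> N \<Longrightarrow> a \<in> A \<Longrightarrow> f a = g b \<Longrightarrow> a \<in> displaced f g A U N"

lemma displaced_subset: "displaced f g A U N \<subseteq> A"
  by (auto elim: displaced.cases)

lemma unmatched_eq: "matching_between A B N \<Longrightarrow> unmatched A B N = B - snd ` N"
  unfolding unmatched_def matching_between_def by force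

text \<open>A displaced rider without partner ends an augmenting path, so an exchange along such
  paths yields a threshold matching with more pairs than \<open>N\<close>.\<close>

lemma displaced_partnered:
  assumes V: "Metric_space V d" "A \<subseteq> V" "B \<subseteq> V" "E \<subseteq> V" and fin: "finite A" "finite B"
    and f: "inj_on f A" "f ` A \<subseteq> E" "\<forall>x \<in> A. d x (f x) \<le> t"
    and g: "inj_on g B" "g ` B \<subseteq> E" "\<forall>x \<in> B. d x (g x) \<le> t"
    and N: "max_threshold_matching d (2 * t) A B N"
  shows "displaced f g A (B - snd ` N) N \<subseteq> fst ` N"
proof (rule ccontr)
  let ?X = "displaced f g A (B - snd ` N) N"
  assume not: "\<not> ?X \<subseteq> fst ` N"
  have N': "N \<subseteq> A \<times> B" "inj_on fst N" "inj_on snd N" "\<forall>(a, b) \<in> N. d a b \<le> 2 * t"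
    using N by (auto simp: max_threshold_matching_def threshold_matching_def matching_between_def)
  \<comment> \<open>Exchanging \<open>N\<close> on the displaced riders for the pairs sharing a driver flips all alternating
     paths from unmatched riders at once.\<close>
  define N2 where "N2 = {(a, b) \<in> N. a \<notin> ?X} \<union> {(a, b). a \<in> ?X \<and> b \<in> B \<and> f a = g b}"
  have XA: "?X \<subseteq> A"
    by (rule displaced_subset)
  \<comment> \<open>By injectivity of \<open>g\<close>, only \<open>b\<close> can have displaced
    \<open>a\<close>. Since \<open>b\<close> is matched, this happened through the rule
    \<open>step\<close>, by its unique partner \<open>a'\<close>.\<close>
  have pred: "a' \<in> ?X" if "a \<in> ?X" "(a', b) \<in> N" "f a = g b" for a a' b
    using that(1)
  proof cases
    case (start u)
    then have "u = b"
      using that N'(1) g(1) by (auto simp: inj_on_def)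
    then show ?thesis
      using start that(2) by force
  next
    case (step a'' b')
    then have "b' = b"
      using that N'(1) g(1) by (auto simp: inj_on_def)
    then have "a'' = a'"
      using step(2) that(2) inj_on_snd_unique[OF N'(3)] by blast
    then show ?thesis
      using step by simp
  qed
  have "N2 \<subseteq> A \<times> B"
    using N'(1) XA by (auto simp: N2_def)
  moreover have "inj_on fst N2"
  proof (rule inj_onI)
    fix x y assume "x \<in> N2" "y \<in> N2" "fst x = fst y"
    then show "x = y"
      using inj_on_fst_unique[OF N'(2)] inj_onD[OF g(1)] by (auto simp: N2_def)
  qed
  moreover have "inj_on snd N2"
  proof (rule inj_onI)
    fix x y assume xy: "x \<in> N2" "y \<in> N2" "snd x = snd y"
    obtain a a' b where eq: "x = (a, b)" "y = (a', b)"
      using xy(3) by (metis prod.collapse)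
    have N2D: "if c \<in> ?X then f c = g b else (c, b) \<in> N" if "(c, b) \<in> N2" for c
      using that by (auto simp: N2_def)
    \<comment> \<open>No mixed case: if one of the two is displaced and shares its driver with
      \<open>b\<close>, then \<open>pred\<close> makes the \<open>N\<close>-partner of
      \<open>b\<close> displaced as well.\<close>
    have "a \<in> ?X \<longleftrightarrow> a' \<in> ?X"
      using xy(1,2) N2D pred unfolding eq by metis
    then have "a = a'"
      using xy(1,2) N2D inj_on_snd_unique[OF N'(3)] inj_onD[OF f(1)] XA unfolding eq
      by (metis subsetD)
    then show "x = y"
      by (simp add: eq)
  qed
  \<comment> \<open>Riders sharing a driver are at distance at most \<open>t + t\<close>; hence the
    threshold of the algorithm.\<close>
  moreover have "d a b \<le> 2 * t" if "a \<in> A" "b \<in> B" "f a = g b" for a b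
  proof -
    have "d a b \<le> d a (f a) + d (f a) b"
      using that f(2) V(2-4) by (intro Metric_space.triangle[OF V(1)]) (auto simp: subset_iff)
    also have "d (f a) b = d b (g b)"
      using that Metric_space.commute[OF V(1)] by simp
    also have "d a (f a) + d b (g b) \<le> t + t"
      using that f(3) g(3) by (intro add_mono) auto
    finally show ?thesis
      by simp
  qed
  ultimately have "threshold_matching d (2 * t) A B N2"
    unfolding threshold_matching_def matching_between_def using N'(4) XA by (auto simp: N2_def)
  then have le: "card N2 \<le> card N"
    using N by (simp add: max_threshold_matching_def)
  have shared: "\<exists>b. (a, b) \<in> N2" if "a \<in> ?X" for a
    using that
  proof cases
    case (start u)
    then show ?thesis
      using that by (auto simp: N2_def)
  next
    case (step a' b)
    then show ?thesis
      using that N'(1) by (auto simp: N2_def)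
  qed
  \<comment> \<open>The exchange keeps every rider of \<open>A\<close> covered by \<open>N\<close>
    and also covers the displaced ones. First components determine the sizes, both matchings being
    injective on them.\<close>
  have fst_N2: "fst ` N \<union> ?X \<subseteq> fst ` N2"
  proof
    fix a assume a: "a \<in> fst ` N \<union> ?X"
    have "\<exists>b. (a, b) \<in> N2"
    proof (cases "a \<in> ?X")
      case True
      then show ?thesis
        by (rule shared)
    next
      case False
      then show ?thesis
        using a by (auto simp: N2_def)
    qed
    then show "a \<in> fst ` N2"
      by force
  qed
  have "finite (fst ` N2)"
    using \<open>N2 \<subseteq> A \<times> B\<close> fin by (intro finite_imageI) (auto intro: finite_subset)
  moreover have "fst ` N \<subset> fst ` N2"
    using fst_N2 not by blast
  ultimately have "card (fst ` N) < card (fst ` N2)"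
    by (rule psubset_card_mono)
  then show False
    using le \<open>inj_on fst N2\<close> N'(2) by (simp add: card_image)
qed

text \<open>By \<open>displaced_partnered\<close>, every displaced rider has a partner whose driver
  it can take. Unmatched riders and partners are distinct elements of \<open>B\<close>, so their
  drivers differ; a rider of \<open>A\<close> whose driver one of them claims is itself
  displaced.\<close>

lemma embeds_merge:
  assumes V: "Metric_space V d" "A \<subseteq> V" "B \<subseteq> V" "E \<subseteq> V" and fin: "finite A" "finite B"
    and t: "0 \<le> t" "embeds d t A E" "embeds d t B E"
    and N: "max_threshold_matching d (2 * t) A B N" and AB: "A \<inter> B \<subseteq> snd ` N"
  shows "embeds d (3 * t) (A \<union> unmatched A B N) E"
proof -
  obtain f where f: "inj_on f A" "f ` A \<subseteq> E" "\<forall>x \<in> A. d x (f x) \<le> t"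
    using t(2) unfolding embeds_def by blast
  obtain g where g: "inj_on g B" "g ` B \<subseteq> E" "\<forall>x \<in> B. d x (g x) \<le> t"
    using t(3) unfolding embeds_def by blast
  have N': "matching_between A B N" "N \<subseteq> A \<times> B" "inj_on fst N" "inj_on snd N"
    "\<forall>(a, b) \<in> N. d a b \<le> 2 * t"
    using N by (auto simp: max_threshold_matching_def threshold_matching_def matching_between_def)
  define U where "U = B - snd ` N"
  define X where "X = displaced f g A U N"
  have X: "X \<subseteq> fst ` N" "X \<subseteq> A"
    unfolding X_def U_def using displaced_partnered[OF V fin f g N] displaced_subset by fast+
  define m where "m a = (SOME b. (a, b) \<in> N)" for a
  have m: "(a, m a) \<in> N" if "a \<in> X" for a
    unfolding m_def by (rule some_snd_in[OF subsetD[OF X(1) that]])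
  \<comment> \<open>On \<open>A \<union> U\<close> the last branch is reached exactly by
    \<open>U\<close>, since the assumption on \<open>A \<inter> B\<close> keeps \<open>U\<close>
    disjoint from \<open>A\<close>.\<close>
  define h where "h a = (if a \<in> X then g (m a) else if a \<in> A then f a else g a)" for a
  have UA: "U \<inter> A = {}" and UB: "U \<subseteq> B"
    using AB by (auto simp: U_def)
  have hX: "h a = g (m a)" "m a \<in> B" "m a \<notin> U" if "a \<in> X" for a
  proof -
    have "m a \<in> snd ` N"
      using m[OF that] by (metis image_eqI snd_conv)
    then show "m a \<notin> U"
      by (simp add: U_def)
    show "m a \<in> B"
      using m[OF that] N'(2) by blast
    show "h a = g (m a)"
      using that by (simp add: h_def)
  qed
  have hA: "h a = f a" if "a \<in> A" "a \<notin> X" for a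
    using that by (simp add: h_def)
  have hU: "h a = g a" if "a \<in> U" for a
    using that UA X(2) by (auto simp: h_def)
  have m_inj: "a = a'" if "a \<in> X" "a' \<in> X" "m a = m a'" for a a'
    using m[OF that(1)] m[OF that(2)] that(3) inj_on_snd_unique[OF N'(4)] by metis
  \<comment> \<open>The rules \<open>start\<close> and \<open>step\<close>, read contrapositively:
    the driver of an undisplaced rider is claimed neither by \<open>U\<close> nor by a displaced
    rider.\<close>
  have disj1: "f a \<noteq> g u" if "a \<in> A" "a \<notin> X" "u \<in> U" for a u
    using that displaced.start[of a A u U f g N] by (auto simp: X_def)
  have disj2: "f a \<noteq> g (m a')" if "a \<in> A" "a \<notin> X" "a' \<in> X" for a a'
    using that displaced.step[of a' f g A U N "m a'" a] m[of a'] by (auto simp: X_def)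
  have gB: "x = y" if "g x = g y" "x \<in> B" "y \<in> B" for x y
    using that g(1) by (auto simp: inj_on_def)
  have h_inj: "inj_on h (A \<union> U)"
  proof (rule inj_onI)
    have *: "x = y" if hyp: "h x = h y" "x \<in> X" "y \<in> A \<union> U" for x y
    proof -
      consider "y \<in> X" | "y \<in> A" "y \<notin> X" | "y \<in> U"
        using hyp by blast
      then show ?thesis
      proof cases
        case 1
        then show ?thesis
          using hyp hX gB m_inj by metis
      next
        case 2
        then show ?thesis
          using hyp hX hA disj2 by metis
      next
        case 3
        then show ?thesis
          using hyp hX hU gB UB by (metis subsetD)
      qed
    qed
    fix x y assume xy: "x \<in> A \<union> U" "y \<in> A \<union> U" "h x = h y"
    consider "x \<in> X" | "y \<in> X" | "x \<in> A" "x \<notin> X" "y \<in> A" "y \<notin> X" | "x \<in> U" "y \<in> U"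
      | "x \<in> A" "x \<notin> X" "y \<in> U" | "y \<in> A" "y \<notin> X" "x \<in> U"
      using xy by blast
    then show "x = y"
    proof cases
      case 1
      then show ?thesis using * xy by blast
    next
      case 2
      then show ?thesis using *[of y x] xy by simp
    next
      case 3
      then show ?thesis using xy hA f(1) by (auto simp: inj_on_def)
    next
      case 4
      then show ?thesis using xy hU gB UB by (metis subsetD)
    next
      case 5
      then show ?thesis using xy hA hU disj1 by metis
    next
      case 6
      then show ?thesis using xy hA hU disj1 by metis
    qed
  qed
  have "h x \<in> E \<and> d x (h x) \<le> 3 * t" if x: "x \<in> A \<union> U" for x
  proof -
    consider "x \<in> X" | "x \<in> A" "x \<notin> X" | "x \<in> U"
      using x by blast
    then show ?thesis
    proof cases
      case 1
      have gm: "g (m x) \<in> E"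
        using hX(2)[OF 1] g(2) by blast
      moreover have "d x (g (m x)) \<le> d x (m x) + d (m x) (g (m x))"
        using 1 X(2) hX(2)[OF 1] V(2-4) gm by (intro Metric_space.triangle[OF V(1)]) (auto simp: subset_iff)
      moreover have "d x (m x) \<le> 2 * t" "d (m x) (g (m x)) \<le> t"
        using m[OF 1] N'(5) g(3) hX(2)[OF 1] by auto
      ultimately show ?thesis
        using hX(1)[OF 1] by simp
    next
      case 2
      then have "d x (f x) \<le> t" "f x \<in> E"
        using f by auto
      then show ?thesis
        using hA[OF 2] t(1) by simp
    next
      case 3
      then have "d x (g x) \<le> t" "g x \<in> E"
        using g UB by auto
      then show ?thesis
        using hU[OF 3] t(1) by simp
    qed
  qed
  then show ?thesis
    unfolding embeds_def unmatched_eq[OF N'(1)] U_def[symmetric]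
    using h_inj by (intro exI[of _ h]) auto
qed

text \<open>Matched riders move to their partners in \<open>A\<close>, the others stay. A rider that
  stays lies outside \<open>A\<close> by the assumption on \<open>A \<inter> B\<close>, so it does
  not collide with a partner.\<close>

lemma embeds_into_merge:
  assumes V: "Metric_space V d" "B \<subseteq> V" and t: "0 \<le> t"
    and N: "threshold_matching d t A B N" and AB: "A \<inter> B \<subseteq> snd ` N"
  shows "embeds d t B (A \<union> unmatched A B N)"
proof -
  have N': "matching_between A B N" "N \<subseteq> A \<times> B" "inj_on fst N" "\<forall>(a, b) \<in> N. d a b \<le> t"
    using N by (auto simp: threshold_matching_def matching_between_def)
  define m where "m b = (SOME a. (a, b) \<in> N)" for b
  have m: "(m b, b) \<in> N" if "b \<in> snd ` N" for b
    unfolding m_def using that by (rule some_fst_in)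
  define h where "h b = (if b \<in> snd ` N then m b else b)" for b
  have m_inj: "b = b'" if "b \<in> snd ` N" "b' \<in> snd ` N" "m b = m b'" for b b'
    using m[OF that(1)] m[OF that(2)] that(3) inj_on_fst_unique[OF N'(3)] by metis
  have mA: "m b \<in> A" if "b \<in> snd ` N" for b
    using m[OF that] N'(2) by blast
  have "inj_on h B"
  proof (rule inj_onI)
    fix x y assume "x \<in> B" "y \<in> B" "h x = h y"
    then show "x = y"
      using m_inj[of x y] mA[of x] mA[of y] AB by (auto simp: h_def split: if_splits)
  qed
  moreover have "h ` B \<subseteq> A \<union> (B - snd ` N)"
    using mA by (auto simp: h_def)
  moreover have "d x (h x) \<le> t" if "x \<in> B" for x
  proof (cases "x \<in> snd ` N")
    case True
    then show ?thesis
      using m[OF True] N'(4) Metric_space.commute[OF V(1), of x] by (auto simp: h_def)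
  next
    case False
    then show ?thesis
      using that t V(2) Metric_space.mdist_zero[OF V(1)] by (auto simp: h_def)
  qed
  ultimately show ?thesis
    unfolding embeds_def unmatched_eq[OF N'(1)] by blast
qed

text \<open>Among the maximum matchings, one with the most diagonal pairs has the required form: at
  an uncovered common rider, inserting a diagonal pair would increase either the size or the number
  of diagonal pairs.\<close>

lemma ex_max_threshold_matching:
  assumes V: "Metric_space V d" "A \<subseteq> V" and fin: "finite A" "finite B" and t: "0 \<le> t"
  shows "\<exists>N. max_threshold_matching d t A B N \<and> A \<inter> B \<subseteq> snd ` N"
proof -
  have finN: "finite N" if "threshold_matching d t A B N" for N
    using that finite_matching[OF _ fin] by (auto simp: threshold_matching_def)
  have card_le: "card N \<le> card (A \<times> B)" if "threshold_matching d t A B N" for N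
    using that fin by (intro card_mono) (auto simp: threshold_matching_def matching_between_def)
  have empty: "threshold_matching d t A B {}"
    by (simp add: threshold_matching_def matching_between_def)
  from ex_has_greatest_nat[of "threshold_matching d t A B" "{}" card "card (A \<times> B) + 1"]
  obtain N0 where "max_threshold_matching d t A B N0"
    using empty card_le unfolding max_threshold_matching_def by (metis less_Suc_eq_le Suc_eq_plus1)
  let ?diag = "\<lambda>N. card (N \<inter> Id)"
  have diag_le: "?diag N < card (A \<times> B) + 1" if "max_threshold_matching d t A B N" for N
  proof -
    have "?diag N \<le> card N"
      using finN that by (intro card_mono) (auto simp: max_threshold_matching_def)
    then show ?thesis
      using card_le[of N] that by (simp add: max_threshold_matching_def)
  qed
  obtain N where N: "max_threshold_matching d t A B N"
    and N_max: "\<And>N'. max_threshold_matching d t A B N' \<Longrightarrow> ?diag N' \<le> ?diag N"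
    using ex_has_greatest_nat[of "max_threshold_matching d t A B" N0 ?diag "card (A \<times> B) + 1"]
      \<open>max_threshold_matching d t A B N0\<close> diag_le by blast
  have thr: "threshold_matching d t A B N" and cardN: "\<And>N'. threshold_matching d t A B N' \<Longrightarrow> card N' \<le> card N"
    using N by (auto simp: max_threshold_matching_def)
  have N': "N \<subseteq> A \<times> B" "inj_on fst N" "inj_on snd N" "\<forall>(a, b) \<in> N. d a b \<le> t" "finite N"
    using thr finN by (auto simp: threshold_matching_def matching_between_def)
  have "r \<in> snd ` N" if r: "r \<in> A" "r \<in> B" for r
  proof (rule ccontr)
    assume nr: "r \<notin> snd ` N"
    have drr: "d r r \<le> t"
      using r V t Metric_space.mdist_zero[OF V(1), of r] by auto
    \<comment> \<open>Dropping the pair that uses \<open>r\<close> on the \<open>A\<close> side, if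
      any, makes room for \<open>(r, r)\<close>, as \<open>r\<close> is free on the \<open>B\<close>
      side.\<close>
    define N1 where "N1 = {x \<in> N. fst x \<noteq> r}"
    have N1: "N1 \<subseteq> N" "r \<notin> fst ` N1" "r \<notin> snd ` N1"
      using nr by (auto simp: N1_def)
    have thr': "threshold_matching d t A B (insert (r, r) N1)"
      unfolding threshold_matching_def matching_between_def
      using N1 N' r drr inj_on_subset[OF N'(2) N1(1)] inj_on_subset[OF N'(3) N1(1)]
      by auto
    have rr: "(r, r) \<notin> N1" "finite N1"
      using finite_subset[OF N1(1) N'(5)] by (simp_all add: N1_def)
    have c': "card (insert (r, r) N1) = Suc (card N1)"
      using rr by simp
    show False
    proof (cases "r \<in> fst ` N")
      case False
      then have "N1 = N"
        by (auto simp: N1_def)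
      then show False
        using cardN[OF thr'] c' by simp
    next
      case True
      then obtain b where b: "(r, b) \<in> N"
        by auto
      have "x = (r, b)" if "x \<in> N" "fst x = r" for x
        using inj_onD[OF N'(2), of x "(r, b)"] that b by simp
      then have N_eq: "N = insert (r, b) N1"
        unfolding N1_def using b by blast
      moreover have "(r, b) \<notin> N1"
        by (simp add: N1_def)
      ultimately have "card N = Suc (card N1)"
        using rr by simp
      then have "max_threshold_matching d t A B (insert (r, r) N1)"
        using thr' cardN c' by (simp add: max_threshold_matching_def)
      moreover have "N \<inter> Id = N1 \<inter> Id"
      proof -
        have "b \<noteq> r"
          using b nr by (metis image_eqI snd_conv)
        then show ?thesis
          by (simp add: N_eq)
      qed
      moreover have "?diag (insert (r, r) N1) = Suc (card (N1 \<inter> Id))"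
        using rr by simp
      ultimately show False
        using N_max by fastforce
    qed
  qed
  then show ?thesis
    using N by blast
qed


section \<open>The rounds of the algorithm\<close>

lemma unmatched_subset: "unmatched A B N \<subseteq> B"
  by (auto simp: unmatched_def)

lemma hat_subset:
  assumes "\<And>j. S j \<subseteq> R"
  shows "hat k M S i j \<subseteq> R"
proof (induction i arbitrary: j)
  case 0
  then show ?case by (simp add: assms)
next
  case (Suc i)
  then show ?case
    using unmatched_subset by (fastforce split: if_splits)
qed

text \<open>Allows the matchings to be chosen round by round: later choices leave earlier sets
  unchanged.\<close>

lemma hat_cong:
  assumes "\<And>i' j. i' \<in> {1..i} \<Longrightarrow> M i' j = M' i' j"
  shows "hat k M S i j = hat k M' S i j"
  using assms
proof (induction i arbitrary: j)
  case (Suc i)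
  then have "hat k M S i j' = hat k M' S i j'" for j'
    by simp
  moreover have "M (Suc i) j = M' (Suc i) j"
    using Suc.prems by simp
  ultimately show ?case
    by simp
qed simp

lemma valid_matchings_step:
  assumes "valid_matchings d k S t M" "i < k" "j \<in> {1..2 ^ (k - Suc i)}"
  shows "max_threshold_matching d (2 * (3 ^ i * t)) (hat k M S i j) (hat k M S i (partner k (Suc i) j))
           (M (Suc i) j)"
    and "hat k M S i j \<inter> hat k M S i (partner k (Suc i) j) \<subseteq> snd ` M (Suc i) j"
proof -
  have "Suc i \<in> {1..k}"
    using assms(2) by simp
  then show "max_threshold_matching d (2 * (3 ^ i * t)) (hat k M S i j)
      (hat k M S i (partner k (Suc i) j)) (M (Suc i) j)"
    and "hat k M S i j \<inter> hat k M S i (partner k (Suc i) j) \<subseteq> snd ` M (Suc i) j"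
    using assms(1,3) unfolding valid_matchings_def Let_def by (fastforce simp: mult.assoc)+
qed

lemma pow_diff_Suc: "i < k \<Longrightarrow> (2::nat) ^ (k - i) = 2 * 2 ^ (k - Suc i)"
  by (metis Suc_diff_Suc power_Suc)

text \<open>Induction on the number of rounds fixed so far, each extended by
  \<open>ex_max_threshold_matching\<close>. The property is proved for every index \<open>j\<close>,
  so no index range has to be carried along.\<close>

lemma ex_valid_matchings:
  assumes V: "Metric_space V d" "R \<subseteq> V" "finite R" and S: "\<And>j. S j \<subseteq> R" and t: "0 \<le> t"
  shows "\<exists>M. valid_matchings d k S t M"
proof -
  let ?ok = "\<lambda>M i j. let A = hat k M S (i - 1) j; B = hat k M S (i - 1) (partner k i j)
        in max_threshold_matching d (2 * 3 ^ (i - 1) * t) A B (M i j) \<and> A \<inter> B \<subseteq> snd ` M i j"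
  have "\<exists>M. \<forall>i \<in> {1..n}. \<forall>j. ?ok M i j" for n
  proof (induction n)
    case (Suc n)
    then obtain M where M: "\<forall>i \<in> {1..n}. \<forall>j. ?ok M i j"
      by blast
    have hat: "hat k M S n j \<subseteq> V" "finite (hat k M S n j)" for j
      using hat_subset[of S R k M n j, OF S] V(2,3) by (auto intro: finite_subset)
    have "\<exists>N. let A = hat k M S n j; B = hat k M S n (partner k (Suc n) j)
        in max_threshold_matching d (2 * 3 ^ n * t) A B N \<and> A \<inter> B \<subseteq> snd ` N" for j
      unfolding Let_def using t by (intro ex_max_threshold_matching[OF V(1) hat(1) hat(2) hat(2)]) simp
    then obtain N where N: "\<And>j. let A = hat k M S n j; B = hat k M S n (partner k (Suc n) j)
        in max_threshold_matching d (2 * 3 ^ n * t) A B (N j) \<and> A \<inter> B \<subseteq> snd ` N j"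
      by metis
    let ?M = "M(Suc n := N)"
    have same: "hat k ?M S i j = hat k M S i j" if "i \<le> n" for i j
      using that by (intro hat_cong) auto
    have "?ok ?M i j" if "i \<in> {1..Suc n}" for i j
    proof (cases "i = Suc n")
      case True
      then show ?thesis
        using N[of j] by (simp add: same)
    next
      case False
      then have "i \<in> {1..n}"
        using that by auto
      moreover from this have "i - 1 \<le> n"
        by auto
      ultimately show ?thesis
        using M False by (simp add: same)
    qed
    then show ?case
      by blast
  qed simp
  then show ?thesis
    unfolding valid_matchings_def by meson
qed

lemma hat_embeds:
  assumes V: "Metric_space V d" "R \<subseteq> V" "finite R" "E \<subseteq> V" and S: "\<And>j. S j \<subseteq> R" and t: "0 \<le> t"
    and E: "\<And>j. embeds d t (S j) E" and M: "valid_matchings d k S t M"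
  shows "i \<le> k \<Longrightarrow> j \<in> {1..2 ^ (k - i)} \<Longrightarrow> embeds d (3 ^ i * t) (hat k M S i j) E"
proof (induction i arbitrary: j)
  case 0
  then show ?case by (simp add: E)
next
  case (Suc i)
  let ?A = "hat k M S i j" and ?B = "hat k M S i (partner k (Suc i) j)"
  have "i < k"
    using Suc.prems by simp
  have sub: "hat k M S i j \<subseteq> V" "finite (hat k M S i j)" for j
    using hat_subset[of S R k M i j, OF S] V(2,3) by (auto intro: finite_subset)
  \<comment> \<open>The active range halves in each round, so both \<open>j\<close> and its partner
    were active before.\<close>
  have "j \<in> {1..2 ^ (k - i)}" "partner k (Suc i) j \<in> {1..2 ^ (k - i)}"
    using Suc.prems(2) by (auto simp: partner_def pow_diff_Suc[OF \<open>i < k\<close>])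
  then have "embeds d (3 ^ i * t) ?A E" "embeds d (3 ^ i * t) ?B E"
    using Suc.IH \<open>i < k\<close> by simp_all
  then have "embeds d (3 * (3 ^ i * t)) (?A \<union> unmatched ?A ?B (M (Suc i) j)) E"
    using embeds_merge[OF V(1) sub(1) sub(1) V(4) sub(2) sub(2)] t
      valid_matchings_step[OF M \<open>i < k\<close> Suc.prems(2)] by simp
  then show ?case
    using Suc.prems(2) by (simp add: mult.assoc)
qed

text \<open>The witness \<open>j'\<close> is the active index into which scenario \<open>j\<close>
  has been absorbed. Each round adds at most \<open>2 * 3 ^ i * t\<close>, which continues the
  geometric sum.\<close>

lemma embeds_hat:
  assumes V: "Metric_space V d" "R \<subseteq> V" and S: "\<And>j. S j \<subseteq> R" and t: "0 \<le> t"
    and M: "valid_matchings d k S t M" and j: "j \<in> {1..2 ^ k}"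
  shows "i \<le> k \<Longrightarrow> \<exists>j' \<in> {1..2 ^ (k - i)}. embeds d ((3 ^ i - 1) * t) (S j) (hat k M S i j')"
proof (induction i)
  case 0
  then show ?case
    using j V S by (intro bexI[of _ j]) (auto intro!: embeds_subset[OF V(1)])
next
  case (Suc i)
  then have "i < k"
    by simp
  have sub: "hat k M S i j \<subseteq> V" for i j
    using V(2) hat_subset[of S R k M i j, OF S] by auto
  obtain j' where j': "j' \<in> {1..2 ^ (k - i)}" "embeds d ((3 ^ i - 1) * t) (S j) (hat k M S i j')"
    using Suc by auto
  \<comment> \<open>Sets in the upper half of the active range are absorbed half a range lower;
    those in the lower half keep their index.\<close>
  define l where "l = (if j' \<le> 2 ^ (k - Suc i) then j' else j' - 2 ^ (k - Suc i))"
  have l: "l \<in> {1..2 ^ (k - Suc i)}" "j' = l \<or> j' = partner k (Suc i) l"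
    using j'(1) by (auto simp: l_def partner_def pow_diff_Suc[OF \<open>i < k\<close>])
  note step = valid_matchings_step[OF M \<open>i < k\<close> l(1)]
  have t': "0 \<le> 2 * (3 ^ i * t)"
    using t by simp
  have "embeds d (2 * (3 ^ i * t)) (hat k M S i j') (hat k M S (Suc i) l)"
    using l(2)
  proof
    assume "j' = l"
    then show ?thesis
      using l(1) by (intro embeds_subset[OF V(1) _ sub t']) auto
  next
    assume "j' = partner k (Suc i) l"
    then show ?thesis
      using l(1) step t' embeds_into_merge[OF V(1) sub t' _ step(2)]
      by (simp add: max_threshold_matching_def)
  qed
  moreover have "S j \<subseteq> V"
    using S V(2) by blast
  ultimately have "embeds d ((3 ^ i - 1) * t + 2 * (3 ^ i * t)) (S j) (hat k M S (Suc i) l)"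
    using embeds_trans[OF V(1) _ sub sub j'(2)] by blast
  moreover have "(3 ^ i - 1) * t + 2 * (3 ^ i * t) = (3 ^ Suc i - 1) * t"
    by (simp add: algebra_simps)
  ultimately show ?case
    using l(1) by auto
qed


section \<open>The approximation guarantee\<close>

text \<open>Ensures that padding cuts off no scenario.\<close>

lemma le_two_power_rounds: "1 \<le> p \<Longrightarrow> p \<le> 2 ^ rounds p"
proof -
  assume "1 \<le> p"
  have "log 2 p \<le> real (rounds p)"
    unfolding rounds_def by linarith
  then have "real p \<le> 2 powr real (rounds p)"
    using \<open>1 \<le> p\<close> by (simp add: log_le_iff)
  then show ?thesis
    by (simp add: powr_realpow)
qed

text \<open>Rounding up costs at most one extra round, hence the factor 3; the rest is
  \<open>3 powr log 2 p = p powr log 2 3\<close>.\<close>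

lemma three_power_rounds_le:
  assumes "1 \<le> p"
  shows "3 ^ rounds p \<le> 3 * real p powr 1.59"
proof -
  have "0 \<le> log 2 p"
    using assms by simp
  then have le: "real (rounds p) \<le> log 2 p + 1"
    unfolding rounds_def by linarith
  \<comment> \<open>An integer certificate for \<open>log 2 3 \<le> 159 / 100\<close>.\<close>
  have "(3::real) powr 100 \<le> 2 powr 159"
    by simp
  then have "log 2 (3 powr 100) \<le> 159"
    by (subst log_le_iff) auto
  moreover have "log 2 (3 powr 100) = 100 * log 2 (3::real)"
    by (rule log_powr)
  ultimately have log3: "log 2 3 \<le> 1.59"
    by simp
  have "3 ^ rounds p = (3::real) powr real (rounds p)"
    by (simp add: powr_realpow)
  also have "\<dots> \<le> 3 powr (log 2 p + 1)"
    using le by (intro powr_mono) auto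
  also have "\<dots> = 3 * 3 powr (log 2 p)"
    by (simp add: powr_add)
  also have "3 powr (log 2 p) = real p powr (log 2 3)"
    using assms by (simp add: powr_def log_def)
  also have "\<dots> \<le> real p powr 1.59"
    using log3 assms by (intro powr_mono) auto
  finally show ?thesis
    by simp
qed

lemma ex_tsrmb_1_scenario:
  assumes "finite D" "feasible R1 D D0"
  shows "\<exists>D1. tsrmb_1_scenario R1 S D d D1"
proof -
  let ?c = "\<lambda>D1. cost1 d D1 R1 + cost2 d (D - D1) S"
  have "finite {D1. feasible R1 D D1}"
    using assms(1) by (simp add: feasible_def)
  then obtain D1 where "D1 \<in> {D1. feasible R1 D D1}" "\<And>D1'. D1' \<in> {D1. feasible R1 D D1} \<Longrightarrow> ?c D1 \<le> ?c D1'"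
    using assms(2) arg_min_if_finite[of "{D1. feasible R1 D D1}" ?c]
    by (metis (no_types, lifting) empty_iff linorder_not_less mem_Collect_eq)
  then show ?thesis
    unfolding tsrmb_1_scenario_def by blast
qed

text \<open>On the merged set, \<open>D1\<close> costs at most as much as \<open>D0\<close>, whose
  second-stage cost there is at most \<open>3 ^ rounds p * OPT2\<close>. Every scenario reaches the
  drivers left by \<open>D1\<close> through the merged set, at an extra
  \<open>(3 ^ rounds p - 1) * OPT2\<close>. Any feasible \<open>D0\<close> can serve as
  reference.\<close>

lemma p_scenario_bound:
  assumes inst: "tsrmb_instance R1 R2 D d p S" and feas: "feasible R1 D D0"
    and OPT2: "OPT2 = worst_cost2 d (D - D0) (S ` {1..p})"
  shows "\<exists>D1. p_scenario_output R1 D d p S OPT2 D1"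
    and "0 \<le> OPT2"
    and "p_scenario_output R1 D d p S OPT2 D1 \<Longrightarrow> feasible R1 D D1 \<and>
      total_cost R1 D d (S ` {1..p}) D1 \<le> cost1 d D0 R1 + (2 * 3 ^ rounds p - 1) * OPT2"
proof -
  define V where "V = R1 \<union> R2 \<union> D"
  have V: "Metric_space V d" and p: "1 \<le> p" and fin: "finite R1" "finite R2" "finite D"
    and SR: "\<And>j. j \<in> {1..p} \<Longrightarrow> S j \<subseteq> R2"
    and card: "\<And>j. j \<in> {1..p} \<Longrightarrow> card R1 + card (S j) \<le> card D"
    using inst by (auto simp: tsrmb_instance_def V_def)
  have sub: "R2 \<subseteq> V" "D \<subseteq> V"
    by (auto simp: V_def)
  have card_diff: "card (D - D') = card D - card R1" if "feasible R1 D D'" for D'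
    using that fin(3) by (auto simp: feasible_def card_Diff_subset finite_subset)
  have worst_ge: "cost2 d A (S j) \<le> worst_cost2 d A (S ` {1..p})" if "j \<in> {1..p}" for A j
    unfolding worst_cost2_def using that by (intro Max_ge) auto
  have att: "0 \<le> cost2 d (D - D0) (S j)" "embeds d (cost2 d (D - D0) (S j)) (S j) (D - D0)"
    if "j \<in> {1..p}" for j
    using that card[OF that] card_diff[OF feas] SR[OF that] fin
    by (auto intro!: cost2_attained[OF V] intro: finite_subset)
  show nonneg: "0 \<le> OPT2"
    using order_trans[OF att(1)[of 1] worst_ge[of 1]] p unfolding OPT2 by simp
  let ?S = "pad p S" and ?k = "rounds p"
  have pad_sub: "?S j \<subseteq> R2" for j
    using SR by (auto simp: pad_def)
  have pad_emb: "embeds d OPT2 (?S j) (D - D0)" for j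
    using embeds_mono[OF att(2) worst_ge subset_refl] by (simp add: pad_def OPT2 embeds_empty)
  obtain M0 where "valid_matchings d ?k ?S OPT2 M0"
    using ex_valid_matchings[where S = ?S, OF V sub(1) fin(2) pad_sub nonneg] by blast
  moreover obtain D2 where "tsrmb_1_scenario R1 (hat ?k M0 ?S ?k 1) D d D2"
    using ex_tsrmb_1_scenario[OF fin(3) feas] by blast
  ultimately show "\<exists>D1. p_scenario_output R1 D d p S OPT2 D1"
    unfolding p_scenario_output_def by blast
  assume "p_scenario_output R1 D d p S OPT2 D1"
  then obtain M where M: "valid_matchings d ?k ?S OPT2 M"
    and D1: "tsrmb_1_scenario R1 (hat ?k M ?S ?k 1) D d D1"
    by (auto simp: p_scenario_output_def)
  define H where "H = hat ?k M ?S ?k 1"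
  have H: "H \<subseteq> R2"
    unfolding H_def using pad_sub by (rule hat_subset)
  then have fin_H: "finite H"
    using fin(2) by (rule finite_subset)
  have feas1: "feasible R1 D D1"
    using D1 by (simp add: tsrmb_1_scenario_def)
  have DV: "D - D' \<subseteq> V" "finite (D - D')" for D'
    using sub fin by auto
  have HV: "H \<subseteq> V"
    using H sub by blast
  have emb: "embeds d (3 ^ ?k * OPT2) H (D - D0)"
    unfolding H_def using hat_embeds[OF V sub(1) fin(2) DV(1) pad_sub nonneg pad_emb M, of ?k 1]
    by simp
  \<comment> \<open>\<open>H\<close> embeds into \<open>D - D0\<close>, which is as large as
    \<open>D - D1\<close>; thus \<open>cost2 d (D - D1) H\<close> is attained.\<close>
  have "card H \<le> card (D - D1)"
    using embeds_card_le[OF emb DV(2)] card_diff[OF feas] card_diff[OF feas1] by simp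
  note attH = cost2_attained[OF V DV(2) fin_H this]
  have "cost1 d D1 R1 + cost2 d (D - D1) H \<le> cost1 d D0 R1 + cost2 d (D - D0) H"
    using D1 feas by (simp add: tsrmb_1_scenario_def H_def)
  moreover have "cost2 d (D - D0) H \<le> 3 ^ ?k * OPT2"
    using nonneg by (intro cost2_le[OF V DV(1) HV DV(2) fin_H _ emb]) simp
  ultimately have c: "cost1 d D1 R1 + cost2 d (D - D1) H \<le> cost1 d D0 R1 + 3 ^ ?k * OPT2"
    by simp
  have "cost2 d (D - D1) (S j) \<le> (3 ^ ?k - 1) * OPT2 + cost2 d (D - D1) H" if j: "j \<in> {1..p}" for j
  proof -
    have "j \<in> {1..2 ^ ?k}"
      using j le_two_power_rounds[OF p] by auto
    then have "embeds d ((3 ^ ?k - 1) * OPT2) (?S j) H"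
      using embeds_hat[OF V sub(1) pad_sub nonneg M, of j ?k] by (simp add: H_def)
    then have e: "embeds d ((3 ^ ?k - 1) * OPT2) (S j) H"
      using j by (simp add: pad_def)
    have SV: "S j \<subseteq> V" "finite (S j)"
      using SR[OF j] sub fin(2) by (auto intro: finite_subset)
    have "0 \<le> (3 ^ ?k - 1) * OPT2 + cost2 d (D - D1) H"
      using nonneg attH(1) by (intro add_nonneg_nonneg mult_nonneg_nonneg) auto
    then show ?thesis
      by (rule cost2_le[OF V DV(1) SV(1) DV(2) SV(2) _ embeds_trans[OF V SV(1) HV DV(1) e attH(2)]])
  qed
  then have "worst_cost2 d (D - D1) (S ` {1..p}) \<le> (3 ^ ?k - 1) * OPT2 + cost2 d (D - D1) H"
    unfolding worst_cost2_def using p by (subst Max_le_iff) auto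
  then show "feasible R1 D D1 \<and>
      total_cost R1 D d (S ` {1..p}) D1 \<le> cost1 d D0 R1 + (2 * 3 ^ rounds p - 1) * OPT2"
    using c feas1 by (simp add: total_cost_def algebra_simps)
qed

theorem theorem5:
  shows "\<exists>C::real. C > 0 \<and>
    (\<forall>(R1 :: 'v set) R2 D d p S Dopt.
       tsrmb_instance R1 R2 D d p S \<longrightarrow>
       optimal_solution R1 D d (S ` {1..p}) Dopt \<longrightarrow>
       (let OPT1 = cost1 d Dopt R1;
            OPT2 = worst_cost2 d (D - Dopt) (S ` {1..p});
            OPT = OPT1 + OPT2
        in (\<exists>D1. p_scenario_output R1 D d p S OPT2 D1) \<and>
           (\<forall>D1. p_scenario_output R1 D d p S OPT2 D1 \<longrightarrow>
              feasible R1 D D1 \<and>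
              total_cost R1 D d (S ` {1..p}) D1 \<le> C * real p powr 1.59 * OPT)))"
\<comment> \<open>The constant is 2 from \<open>p_scenario_bound\<close> times 3 from
  \<open>three_power_rounds_le\<close>.\<close>
proof (intro exI[of _ 6] conjI allI impI)
  fix R1 R2 D :: "'v set" and d p S Dopt
  assume inst: "tsrmb_instance R1 R2 D d p S" and opt: "optimal_solution R1 D d (S ` {1..p}) Dopt"
  define OPT1 where "OPT1 = cost1 d Dopt R1"
  define OPT2 where "OPT2 = worst_cost2 d (D - Dopt) (S ` {1..p})"
  have feas: "feasible R1 D Dopt"
    using opt by (simp add: optimal_solution_def)
  note bound = p_scenario_bound[OF inst feas OPT2_def]
  have V: "Metric_space (R1 \<union> R2 \<union> D) d" and fin: "finite R1" "finite D" and p: "1 \<le> p"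
    using inst by (auto simp: tsrmb_instance_def)
  have "0 \<le> OPT1"
    unfolding OPT1_def using feas fin
    by (intro cost1_nonneg[OF V]) (auto simp: feasible_def intro: finite_subset)
  \<comment> \<open>\<open>OPT1\<close> enters the bound with coefficient 1, so it can be absorbed
    since it is nonnegative.\<close>
  moreover have "1 \<le> real p powr 1.59"
    using p by (intro ge_one_powr_ge_zero) auto
  ultimately have "OPT1 \<le> 6 * real p powr 1.59 * OPT1"
    using mult_right_mono[of 1 "6 * real p powr 1.59" OPT1] by simp
  moreover have "(2 * 3 ^ rounds p - 1) * OPT2 \<le> 6 * real p powr 1.59 * OPT2"
    using three_power_rounds_le[OF p] bound(2) by (intro mult_right_mono) auto
  ultimately have "OPT1 + (2 * 3 ^ rounds p - 1) * OPT2 \<le> 6 * real p powr 1.59 * (OPT1 + OPT2)"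
    by (simp add: algebra_simps)
  then have "\<forall>D1. p_scenario_output R1 D d p S OPT2 D1 \<longrightarrow> feasible R1 D D1 \<and>
      total_cost R1 D d (S ` {1..p}) D1 \<le> 6 * real p powr 1.59 * (OPT1 + OPT2)"
    using bound(3) unfolding OPT1_def[symmetric] by (meson order_trans)
  then show "let OPT1 = cost1 d Dopt R1;
            OPT2 = worst_cost2 d (D - Dopt) (S ` {1..p});
            OPT = OPT1 + OPT2
        in (\<exists>D1. p_scenario_output R1 D d p S OPT2 D1) \<and>
           (\<forall>D1. p_scenario_output R1 D d p S OPT2 D1 \<longrightarrow>
              feasible R1 D D1 \<and>
              total_cost R1 D d (S ` {1..p}) D1 \<le> 6 * real p powr 1.59 * OPT)"
    unfolding Let_def OPT1_def[symmetric] OPT2_def[symmetric] using bound(1) by blast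
qed simp

end
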